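(* Let $n \ge 3$ and let $S$ be a set of transpositions generating $S_n$ such that the Cayley graph $X=\mathrm{Cay}(S_n,S)$ is normal. Then $\mathrm{Aut}(X)$ is isomorphic to the direct product $S_n \times \mathrm{Aut}(T(S))$, where $T(S)$ is the transposition graph of $S$.
   Context: For a group $H$ and $S \subseteq H$ with $1 \notin S = S^{-1}$, $\mathrm{Cay}(H,S)$ is the simple undirected graph with vertex set $H$ in which $h$ and $sh$ are adjacent for all $h \in H$, $s\in S$. The right regular representation $R(H)$ consists of the permutations $x \mapsto xa$ of $H$, $a \in H$; these are automorphisms of $\mathrm{Cay}(H,S)$. The Cayley graph is called normal if $R(H)$ is a normal subgroup of its full automorphism group $\mathrm{Aut}(\mathrm{Cay}(H,S))$. For a set $S$ of transpositions in $S_n$, the transposition graph $T(S)$ is the graph with vertex set $\{1,\ldots,n\}$ in which $i$ and $j$ are adjacent iff $(i,j) \in S$; $\mathrm{Aut}(T(S))$ is its automorphism group (a subgroup of $S_n$). *)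

theory Defs
  imports "HOL-Algebra.Sym_Groups" "Graph_Theory.Pair_Digraph"
begin

(* Simple undirected graphs are loop-free symmetric digraphs without parallel arcs: an edge {u, v}
   is the pair of arcs (u, v), (v, u). *)

(* Permutations of the vertex set are functions fixing everything outside it, as in sym_group, so
   for a graph on {1..n} this is literally a subgroup of sym_group n. *)
definition graph_aut :: "'a pair_pre_digraph \<Rightarrow> ('a \<Rightarrow> 'a) monoid" where
  "graph_aut G =
    \<lparr>carrier = {f. f permutes pverts G \<and>
        (\<forall>u\<in>pverts G. \<forall>v\<in>pverts G. (f u, f v) \<in> parcs G \<longleftrightarrow> (u, v) \<in> parcs G)},
     mult = (\<circ>), one = id\<rparr>"

(* Meaningful for subsets S of the carrier that are closed under inverses and do not contain 1. *)
definition cayley_graph :: "('a, 'b) monoid_scheme \<Rightarrow> 'a set \<Rightarrow> 'a pair_pre_digraph" where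
  "cayley_graph H S =
    \<lparr>pverts = carrier H, parcs = {(h, s \<otimes>\<^bsub>H\<^esub> h) | h s. h \<in> carrier H \<and> s \<in> S}\<rparr>"

definition right_regular :: "('a, 'b) monoid_scheme \<Rightarrow> ('a \<Rightarrow> 'a) set" where
  "right_regular H =
    {\<lambda>x. if x \<in> carrier H then x \<otimes>\<^bsub>H\<^esub> a else x | a. a \<in> carrier H}"

definition normal_cayley_graph :: "('a, 'b) monoid_scheme \<Rightarrow> 'a set \<Rightarrow> bool" where
  "normal_cayley_graph H S \<longleftrightarrow> right_regular H \<lhd> graph_aut (cayley_graph H S)"

definition transpositions :: "nat \<Rightarrow> (nat \<Rightarrow> nat) set" where
  "transpositions n =
    {Transposition.transpose i j | i j. i \<in> {1..n} \<and> j \<in> {1..n} \<and> i \<noteq> j}"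

definition transposition_graph :: "nat \<Rightarrow> (nat \<Rightarrow> nat) set \<Rightarrow> nat pair_pre_digraph" where
  "transposition_graph n S =
    \<lparr>pverts = {1..n},
     parcs = {(i, j). i \<in> {1..n} \<and> j \<in> {1..n} \<and> i \<noteq> j \<and> Transposition.transpose i j \<in> S}\<rparr>"

lemma group_graph_aut: "group (graph_aut G)"
proof (rule groupI)
  fix f assume f: "f \<in> carrier (graph_aut G)"
  then have p: "f permutes pverts G" by (simp add: graph_aut_def)
  have "inv' f \<in> carrier (graph_aut G)"
    unfolding graph_aut_def
  proof (simp, intro conjI ballI)
    show "inv' f permutes pverts G" by (rule permutes_inv[OF p])
    fix u v assume "u \<in> pverts G" "v \<in> pverts G"
    then have "inv' f u \<in> pverts G" "inv' f v \<in> pverts G"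
      using permutes_in_image[OF permutes_inv[OF p]] by auto
    then show "(inv' f u, inv' f v) \<in> parcs G \<longleftrightarrow> (u, v) \<in> parcs G"
      using f permutes_inverses[OF p] by (force simp: graph_aut_def)
  qed
  moreover have "inv' f \<circ> f = id" by (rule permutes_inv_o(2)[OF p])
  ultimately show "\<exists>g\<in>carrier (graph_aut G). g \<otimes>\<^bsub>graph_aut G\<^esub> f = \<one>\<^bsub>graph_aut G\<^esub>"
    by (auto simp: graph_aut_def)
qed (auto simp: graph_aut_def permutes_compose permutes_id permutes_in_image)

lemma pair_bidirected_digraph_cayley_graph:
  assumes "group H" "S \<subseteq> carrier H" "\<one>\<^bsub>H\<^esub> \<notin> S" "\<And>s. s \<in> S \<Longrightarrow> inv\<^bsub>H\<^esub> s \<in> S"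
  shows "pair_bidirected_digraph (cayley_graph H S)"
proof -
  interpret group H by fact
  have sym: "(s \<otimes>\<^bsub>H\<^esub> h, h) \<in> parcs (cayley_graph H S)" if "h \<in> carrier H" "s \<in> S" for h s
  proof -
    have "s \<in> carrier H" using that assms(2) by blast
    then have "h = inv\<^bsub>H\<^esub> s \<otimes>\<^bsub>H\<^esub> (s \<otimes>\<^bsub>H\<^esub> h)" "s \<otimes>\<^bsub>H\<^esub> h \<in> carrier H"
      using that by (auto simp: m_assoc[symmetric])
    then show ?thesis using assms(4)[OF that(2)] unfolding cayley_graph_def by auto
  qed
  have noloop: "s \<otimes>\<^bsub>H\<^esub> h \<noteq> h" if "h \<in> carrier H" "s \<in> S" for h s
  proof -
    have "s \<in> carrier H" "s \<noteq> \<one>\<^bsub>H\<^esub>" using that assms(2,3) by auto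
    then show ?thesis using that(1) right_cancel[of h s "\<one>\<^bsub>H\<^esub>"] by simp
  qed
  have "Relation.sym (parcs (cayley_graph H S))"
  proof (rule symI)
    fix u v assume "(u, v) \<in> parcs (cayley_graph H S)"
    then obtain s where "u \<in> carrier H" "s \<in> S" "v = s \<otimes>\<^bsub>H\<^esub> u"
      by (auto simp: cayley_graph_def)
    then show "(v, u) \<in> parcs (cayley_graph H S)" using sym by simp
  qed
  then have "symmetric (cayley_graph H S)"
    by (simp add: symmetric_def arcs_ends_def arc_to_ends_def)
  moreover have "fst e \<in> pverts (cayley_graph H S)" "snd e \<in> pverts (cayley_graph H S)" "fst e \<noteq> snd e"
    if "e \<in> parcs (cayley_graph H S)" for e
  proof -
    obtain h s where e: "e = (h, s \<otimes>\<^bsub>H\<^esub> h)" and hs: "h \<in> carrier H" "s \<in> S"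
      using \<open>e \<in> parcs (cayley_graph H S)\<close> by (auto simp: cayley_graph_def)
    moreover have "s \<otimes>\<^bsub>H\<^esub> h \<in> carrier H" using hs assms(2) by blast
    ultimately show "fst e \<in> pverts (cayley_graph H S)" "snd e \<in> pverts (cayley_graph H S)"
      "fst e \<noteq> snd e"
      using noloop[OF hs] by (simp_all add: cayley_graph_def)
  qed
  ultimately show ?thesis by unfold_locales
qed

lemma right_regular_subset_graph_aut:
  assumes "group H" "S \<subseteq> carrier H"
  shows "right_regular H \<subseteq> carrier (graph_aut (cayley_graph H S))"
proof
  interpret group H by fact
  fix f assume "f \<in> right_regular H"
  then obtain a where a: "a \<in> carrier H"
    and f: "f = (\<lambda>x. if x \<in> carrier H then x \<otimes>\<^bsub>H\<^esub> a else x)"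
    by (auto simp: right_regular_def)
  have "bij_betw f (carrier H) (carrier H)"
    by (rule bij_betw_byWitness[where f' = "\<lambda>x. x \<otimes>\<^bsub>H\<^esub> inv\<^bsub>H\<^esub> a"])
       (use a in \<open>auto simp: f m_assoc\<close>)
  then have p: "f permutes carrier H" by (rule bij_imp_permutes) (simp add: f)
  have "(f u, f v) \<in> parcs (cayley_graph H S) \<longleftrightarrow> (u, v) \<in> parcs (cayley_graph H S)"
    if uv: "u \<in> carrier H" "v \<in> carrier H" for u v
  proof -
    have "v \<otimes>\<^bsub>H\<^esub> a = s \<otimes>\<^bsub>H\<^esub> (u \<otimes>\<^bsub>H\<^esub> a) \<longleftrightarrow> v = s \<otimes>\<^bsub>H\<^esub> u" if "s \<in> S" for s
    proof -
      have "s \<in> carrier H" using that assms(2) by blast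
      then show ?thesis using uv a by (simp add: m_assoc[symmetric])
    qed
    then show ?thesis using uv a by (auto simp: cayley_graph_def f)
  qed
  with p show "f \<in> carrier (graph_aut (cayley_graph H S))"
    by (simp add: graph_aut_def) (simp add: cayley_graph_def)
qed

lemma pair_graph_transposition_graph: "pair_graph (transposition_graph n S)"
proof -
  have "finite (parcs (transposition_graph n S))"
    by (rule finite_subset[of _ "{1..n} \<times> {1..n}"]) (auto simp: transposition_graph_def)
  moreover have "sym (parcs (transposition_graph n S))"
    by (auto simp: transposition_graph_def transpose_commute intro!: symI)
  ultimately show ?thesis
    by unfold_locales
       (auto simp: transposition_graph_def symmetric_def arcs_ends_def arc_to_ends_def)
qed

lemma subgroup_graph_aut_transposition_graph:
  "subgroup (carrier (graph_aut (transposition_graph n S))) (sym_group n)"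
proof -
  interpret A: group "graph_aut (transposition_graph n S)" by (rule group_graph_aut)
  have "group ((sym_group n)\<lparr>carrier := carrier (graph_aut (transposition_graph n S))\<rparr>)"
    using A.is_group by (simp add: graph_aut_def sym_group_def)
  then show ?thesis
    by (intro group.group_incl_imp_subgroup[OF sym_group_is_group])
       (auto simp: graph_aut_def sym_group_def transposition_graph_def)
qed

end

theory Submission
  imports Defs
begin

text \<open>
  Left multiplication by an element \<open>g\<close> of \<open>Aut(T(S))\<close> is an automorphism of the Cayley graph,
  because \<open>g\<close> normalises \<open>S\<close>. It commutes with right multiplications, so
  \<open>(a, g) \<mapsto> (x \<mapsto> g x a\<^sup>-\<^sup>1)\<close> is a homomorphism from \<open>S\<^sub>n \<times> Aut(T(S))\<close> to \<open>Aut(X)\<close>, which is injective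
  because the centre of \<open>S\<^sub>n\<close> is trivial. By normality, an automorphism of \<open>X\<close> that fixes the identity
  is a group automorphism of \<open>S\<^sub>n\<close> preserving \<open>S\<close>. As all transpositions are conjugate, it maps every
  transposition to a transposition, hence it is conjugation by some \<open>g\<close>, and \<open>g\<close> lies in \<open>Aut(T(S))\<close>
  because \<open>S\<close> is preserved. This gives surjectivity.
\<close>

section \<open>Transpositions and conjugation in symmetric groups\<close>

abbreviation transp :: "'a \<Rightarrow> 'a \<Rightarrow> 'a \<Rightarrow> 'a" where
  "transp \<equiv> Transposition.transpose"

lemma transp_eq_transp_iff:
  assumes "a \<noteq> b"
  shows "transp a b = transp c d \<longleftrightarrow> (a = c \<and> b = d) \<or> (a = d \<and> b = c)"
proof
  assume eq: "transp a b = transp c d"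
  show "(a = c \<and> b = d) \<or> (a = d \<and> b = c)"
    using fun_cong[OF eq, of a] fun_cong[OF eq, of b] assms
    by (auto simp: Transposition.transpose_def split: if_splits)
qed (auto simp: transpose_commute)

lemma conj_transp:
  assumes "bij g"
  shows "g \<circ> transp a b \<circ> inv' g = transp (g a) (g b)"
  using transpose_comp_eq[OF assms, of "g a" "g b"] assms
  by (metis bij_betw_def comp_assoc comp_id inv_f_f surj_iff)

text \<open>Transpositions with disjoint supports commute. In contrapositive form this extracts a
  common point from a failure to commute, a property that injective homomorphisms transport.\<close>

lemma not_commute_transp_share_point:
  assumes "transp a b \<circ> transp c d \<noteq> transp c d \<circ> transp a b"
  shows "c \<in> {a, b} \<or> d \<in> {a, b}"
proof (rule ccontr)
  assume "\<not> ?thesis"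
  then have "transp a b \<circ> transp c d = transp c d \<circ> transp a b"
    by (auto simp: fun_eq_iff Transposition.transpose_def)
  then show False using assms by contradiction
qed

text \<open>The two products send the common point \<open>a\<close> to \<open>c\<close> and to
  \<open>b\<close> respectively.\<close>

lemma not_commute_transp_of_common_point:
  assumes "a \<noteq> b" "a \<noteq> c" "b \<noteq> c"
  shows "transp a b \<circ> transp a c \<noteq> transp a c \<circ> transp a b"
proof
  assume "transp a b \<circ> transp a c = transp a c \<circ> transp a b"
  from fun_cong[OF this, of a] show False using assms by simp
qed

text \<open>The first swap places \<open>u\<close> at \<open>i\<close> and moves \<open>v\<close> to
  some \<open>w\<close>. The second takes \<open>w\<close> to \<open>j\<close> without disturbing
  \<open>i\<close>, as neither \<open>w\<close> nor \<open>j\<close> equals \<open>i\<close>.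
  Conjugating by \<open>h\<close> then carries \<open>transp u v\<close> to
  \<open>transp i j\<close>.\<close>

lemma ex_permutes_two_points:
  assumes "u \<in> A" "v \<in> A" "i \<in> A" "j \<in> A" "u \<noteq> v" "i \<noteq> j"
  obtains h where "h permutes A" "h u = i" "h v = j"
proof
  define w where "w = transp u i v"
  have w: "w \<in> A" "w \<noteq> i" using assms by (auto simp: w_def Transposition.transpose_def)
  show "transp w j \<circ> transp u i permutes A"
    using assms w by (intro permutes_compose permutes_swap_id)
  show "(transp w j \<circ> transp u i) u = i" using w assms by simp
  show "(transp w j \<circ> transp u i) v = j" by (simp flip: w_def)
qed

text \<open>Pairwise non-commuting transpositions share a common point or form a triangle. The images of
  the transpositions through \<open>p\<close> cannot form a triangle, because the third side of a triangle on
  the images of \<open>(p q)\<close> and \<open>(p r)\<close> is the image of \<open>(q r)\<close>. So they share a point \<open>a\<close>, and \<open>g\<close> sends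
  \<open>p\<close> to \<open>a\<close> and \<open>i\<close> to the second point moved by the image of \<open>(p i)\<close>.\<close>

lemma transp_preserving_endomorphism_is_conjugation:
  fixes \<phi> :: "('a \<Rightarrow> 'a) \<Rightarrow> 'a \<Rightarrow> 'a"
  assumes fin: "finite A" and pqr: "{p, q, r} \<subseteq> A" "p \<noteq> q" "p \<noteq> r" "q \<noteq> r"
    and inj: "inj_on \<phi> {\<pi>. \<pi> permutes A}"
    and hom: "\<And>\<pi> \<sigma>. \<pi> permutes A \<Longrightarrow> \<sigma> permutes A \<Longrightarrow> \<phi> (\<pi> \<circ> \<sigma>) = \<phi> \<pi> \<circ> \<phi> \<sigma>"
    and transp: "\<And>i j. i \<in> A \<Longrightarrow> j \<in> A \<Longrightarrow> i \<noteq> j \<Longrightarrow>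
      \<exists>a\<in>A. \<exists>b\<in>A. a \<noteq> b \<and> \<phi> (transp i j) = transp a b"
  shows "\<exists>g. g permutes A \<and> (\<forall>\<pi>. \<pi> permutes A \<longrightarrow> \<phi> \<pi> = g \<circ> \<pi> \<circ> inv' g)"
proof -
  have tA: "transp i j permutes A" if "i \<in> A" "j \<in> A" for i j
    using that by (rule permutes_swap_id)
  have noncomm: "\<phi> (transp p i) \<circ> \<phi> (transp p j) \<noteq> \<phi> (transp p j) \<circ> \<phi> (transp p i)"
    if "i \<in> A" "j \<in> A" "i \<noteq> p" "j \<noteq> p" "i \<noteq> j" for i j
  proof -
    have "transp p i \<circ> transp p j \<noteq> transp p j \<circ> transp p i"
      using that by (intro not_commute_transp_of_common_point) auto
    moreover have "transp p i \<circ> transp p j permutes A" "transp p j \<circ> transp p i permutes A"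
      using that pqr by (auto intro!: permutes_compose tA)
    ultimately have "\<phi> (transp p i \<circ> transp p j) \<noteq> \<phi> (transp p j \<circ> transp p i)"
      using inj by (auto dest: inj_onD)
    then show ?thesis using that pqr by (simp add: hom tA)
  qed
  have "\<exists>a b c. a \<in> A \<and> b \<in> A \<and> c \<in> A \<and> a \<noteq> b \<and> a \<noteq> c \<and> b \<noteq> c \<and>
      \<phi> (transp p q) = transp a b \<and> \<phi> (transp p r) = transp a c"
  proof -
    obtain a b where ab: "a \<in> A" "b \<in> A" "a \<noteq> b" "\<phi> (transp p q) = transp a b"
      using transp[of p q] pqr by auto
    obtain c d where cd: "c \<in> A" "d \<in> A" "c \<noteq> d" "\<phi> (transp p r) = transp c d"
      using transp[of p r] pqr by auto
    have nc: "transp a b \<circ> transp c d \<noteq> transp c d \<circ> transp a b"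
      using noncomm[of q r] pqr ab cd by auto
    \<comment> \<open>The images share a point, which becomes \<open>a\<close> after relabelling;
      being different transpositions, they have distinct second points.\<close>
    then have "transp a b \<noteq> transp c d" by auto
    then show ?thesis
      using not_commute_transp_share_point[OF nc] ab cd
      by (metis insert_iff singletonD transpose_commute)
  qed
  then obtain a b c where abc: "a \<in> A" "b \<in> A" "c \<in> A" "a \<noteq> b" "a \<noteq> c" "b \<noteq> c"
    and pq: "\<phi> (transp p q) = transp a b" and pr: "\<phi> (transp p r) = transp a c" by blast
  have qr: "\<phi> (transp q r) = transp b c"
  proof -
    have "transp q r = transp p q \<circ> transp p r \<circ> transp p q"
      using transpose_comp_triple[of q r p] pqr by (simp add: transpose_commute)
    then have "\<phi> (transp q r) = transp a b \<circ> transp a c \<circ> transp a b"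
      using pqr by (simp add: hom tA permutes_compose pq pr)
    also have "\<dots> = transp b c"
      using transpose_comp_triple[of b c a] abc by (simp add: transpose_commute)
    finally show ?thesis .
  qed
  have "\<exists>d\<in>A. d \<noteq> a \<and> \<phi> (transp p i) = transp a d" if i: "i \<in> A" "i \<noteq> p" for i
  proof (cases "i = q \<or> i = r")
    case True
    then show ?thesis using pq pr abc by auto
  next
    case False
    obtain x y where xy: "x \<in> A" "y \<in> A" "x \<noteq> y" "\<phi> (transp p i) = transp x y"
      using transp[of p i] i pqr by auto
    have "transp a b \<circ> transp x y \<noteq> transp x y \<circ> transp a b"
      using noncomm[of q i] i pqr False xy pq by auto
    moreover have "transp a c \<circ> transp x y \<noteq> transp x y \<circ> transp a c"
      using noncomm[of r i] i pqr False xy pr by auto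
    ultimately have "x \<in> {a, b} \<or> y \<in> {a, b}" "x \<in> {a, c} \<or> y \<in> {a, c}"
      by (blast dest: not_commute_transp_share_point)+
    moreover have "transp x y \<noteq> transp b c"
    proof
      assume "transp x y = transp b c"
      then have "\<phi> (transp p i) = \<phi> (transp q r)" using xy qr by simp
      then have "transp p i = transp q r"
        using inj tA i pqr by (auto dest: inj_onD)
      then show False using i pqr False by (auto simp: transp_eq_transp_iff)
    qed
    ultimately have "x = a \<or> y = a" using abc by (auto simp: transpose_commute)
    then show ?thesis using xy by (auto simp: transpose_commute)
  qed
  then obtain d where d: "\<And>i. i \<in> A \<Longrightarrow> i \<noteq> p \<Longrightarrow>
      d i \<in> A \<and> d i \<noteq> a \<and> \<phi> (transp p i) = transp a (d i)"
    by metis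
  define g where "g = (\<lambda>i. if i \<in> A then if i = p then a else d i else i)"
  have "inj_on g A"
  proof (rule inj_onI)
    fix i j assume ij: "i \<in> A" "j \<in> A" "g i = g j"
    show "i = j"
    proof (cases "i = p \<or> j = p")
      case True
      then show ?thesis using ij d by (auto simp: g_def split: if_splits)
    next
      case False
      then have "\<phi> (transp p i) = \<phi> (transp p j)" using ij d by (auto simp: g_def)
      then have "transp p i = transp p j" using inj tA ij pqr by (auto dest: inj_onD)
      then show ?thesis using False by (auto simp: transp_eq_transp_iff)
    qed
  qed
  moreover have "g ` A \<subseteq> A" using d abc by (auto simp: g_def)
  ultimately have "bij_betw g A A"
    using fin by (simp add: bij_betw_def endo_inj_surj)
  then have gA: "g permutes A" by (rule bij_imp_permutes) (simp add: g_def)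
  then have bg: "bij g" by (rule permutes_bij)
  have conj: "g \<circ> (\<pi> \<circ> \<sigma>) \<circ> inv' g = (g \<circ> \<pi> \<circ> inv' g) \<circ> (g \<circ> \<sigma> \<circ> inv' g)" for \<pi> \<sigma>
    using permutes_inverses[OF gA] by (auto simp: fun_eq_iff)
  have base: "\<phi> (transp p i) = g \<circ> transp p i \<circ> inv' g" if "i \<in> A" "i \<noteq> p" for i
  proof -
    have "g p = a" "g i = d i" using that pqr by (simp_all add: g_def)
    then show ?thesis using d[OF that] conj_transp[OF bg, of p i] by metis
  qed
  have step: "\<phi> (transp i j) = g \<circ> transp i j \<circ> inv' g" if ij: "i \<in> A" "j \<in> A" "i \<noteq> j" for i j
  proof (cases "i = p \<or> j = p")
    case True
    then show ?thesis using base ij by (metis transpose_commute)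
  next
    case False
    \<comment> \<open>Conjugating \<open>(p j)\<close> by \<open>(p i)\<close> gives
      \<open>(i j)\<close>, so agreement on the transpositions through \<open>p\<close> extends to
      all transpositions.\<close>
    then have *: "transp i j = transp p i \<circ> transp p j \<circ> transp p i"
      using transpose_comp_triple[of i j p] ij by (auto simp: transpose_commute)
    have "\<phi> (transp i j) = \<phi> (transp p i) \<circ> \<phi> (transp p j) \<circ> \<phi> (transp p i)"
      unfolding * using pqr ij by (simp add: hom tA permutes_compose)
    then show ?thesis unfolding * conj using base ij False by simp
  qed
  \<comment> \<open>Only multiplicativity of \<open>\<phi>\<close> is given, so the value at
    \<open>id\<close> is found by cancelling the involution \<open>transp a b\<close> on the
    right.\<close>
  have "\<phi> id \<circ> \<phi> (transp p q) = \<phi> (transp p q)"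
    using hom[of id "transp p q"] tA pqr by (simp add: permutes_id)
  then have "\<phi> id \<circ> (transp a b \<circ> transp a b) = transp a b \<circ> transp a b"
    unfolding pq by (metis comp_assoc)
  then have id: "\<phi> id = id" by simp
  have "\<phi> \<pi> = g \<circ> \<pi> \<circ> inv' g" if "\<pi> permutes A" for \<pi>
    using that fin
  proof (induction rule: permutes_induct)
    case id
    then show ?case using \<open>\<phi> id = id\<close> permutes_inv_o(1)[OF gA] by (simp add: id_def o_def)
  next
    case (swap i j \<pi>)
    have "\<phi> (transp i j \<circ> \<pi>) = \<phi> (transp i j) \<circ> \<phi> \<pi>" using swap by (intro hom tA)
    also have "\<dots> = g \<circ> (transp i j \<circ> \<pi>) \<circ> inv' g"
      unfolding conj swap.IH step[OF swap.hyps(1-3)] ..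
    finally show ?case .
  qed
  with gA show ?thesis by blast
qed

section \<open>Translations and automorphisms of Cayley graphs\<close>

text \<open>The inverse on \<open>a\<close> makes the map multiplicative in the pair
  \<open>(a, g)\<close>. Points outside the carrier are fixed, as \<open>permutes\<close> in
  \<open>graph_aut\<close> demands.\<close>

definition two_sided_mult :: "('a, 'b) monoid_scheme \<Rightarrow> 'a \<Rightarrow> 'a \<Rightarrow> 'a \<Rightarrow> 'a" where
  "two_sided_mult H a g =
    (\<lambda>x. if x \<in> carrier H then g \<otimes>\<^bsub>H\<^esub> x \<otimes>\<^bsub>H\<^esub> inv\<^bsub>H\<^esub> a else x)"

context group
begin

lemma inv_cancel_left:
  assumes "x \<in> carrier G" "y \<in> carrier G"
  shows "inv x \<otimes> (x \<otimes> y) = y" "x \<otimes> (inv x \<otimes> y) = y"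
  using assms by (simp_all flip: m_assoc)

text \<open>Turns adjacency into membership of a quotient in \<open>S\<close>, so that automorphism
  checks become group computations.\<close>

lemma cayley_arc_iff:
  assumes "S \<subseteq> carrier G" "u \<in> carrier G" "v \<in> carrier G"
  shows "(u, v) \<in> parcs (cayley_graph G S) \<longleftrightarrow> v \<otimes> inv u \<in> S"
proof
  assume "(u, v) \<in> parcs (cayley_graph G S)"
  then obtain s where "s \<in> S" "v = s \<otimes> u" by (auto simp: cayley_graph_def)
  then show "v \<otimes> inv u \<in> S" using assms by (auto simp: m_assoc subsetD)
next
  assume "v \<otimes> inv u \<in> S"
  moreover have "v = (v \<otimes> inv u) \<otimes> u" using assms by (simp add: m_assoc)
  ultimately show "(u, v) \<in> parcs (cayley_graph G S)"
    using assms unfolding cayley_graph_def by auto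
qed

lemma two_sided_mult_comp:
  assumes "a \<in> carrier G" "b \<in> carrier G" "g \<in> carrier G" "h \<in> carrier G"
  shows "two_sided_mult G (a \<otimes> b) (g \<otimes> h) = two_sided_mult G a g \<circ> two_sided_mult G b h"
  using assms by (auto simp: two_sided_mult_def fun_eq_iff m_assoc inv_mult_group)

lemma two_sided_mult_permutes:
  assumes "a \<in> carrier G" "g \<in> carrier G"
  shows "two_sided_mult G a g permutes carrier G"
proof (rule bij_imp_permutes)
  show "bij_betw (two_sided_mult G a g) (carrier G) (carrier G)"
    by (rule bij_betw_byWitness[where f' = "two_sided_mult G (inv a) (inv g)"])
      (use assms in \<open>auto simp: two_sided_mult_def m_assoc inv_cancel_left\<close>)
qed (simp add: two_sided_mult_def)

text \<open>In the quotient of two image vertices the factor \<open>a\<close> cancels and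
  \<open>g\<close> acts by conjugation, under which \<open>S\<close> is invariant.\<close>

lemma two_sided_mult_in_graph_aut:
  assumes S: "S \<subseteq> carrier G" and ag: "a \<in> carrier G" "g \<in> carrier G"
    and inv: "\<And>s. s \<in> carrier G \<Longrightarrow> g \<otimes> s \<otimes> inv g \<in> S \<longleftrightarrow> s \<in> S"
  shows "two_sided_mult G a g \<in> carrier (graph_aut (cayley_graph G S))"
proof -
  let ?f = "two_sided_mult G a g"
  have "(?f u, ?f v) \<in> parcs (cayley_graph G S) \<longleftrightarrow> (u, v) \<in> parcs (cayley_graph G S)"
    if uv: "u \<in> carrier G" "v \<in> carrier G" for u v
  proof -
    have f: "?f u \<in> carrier G" "?f v \<in> carrier G" using uv ag by (auto simp: two_sided_mult_def)
    have "?f v \<otimes> inv (?f u) = g \<otimes> (v \<otimes> inv u) \<otimes> inv g"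
      using uv ag by (simp add: two_sided_mult_def m_assoc inv_mult_group inv_cancel_left)
    then show ?thesis
      using uv f inv[of "v \<otimes> inv u"] by (simp add: cayley_arc_iff[OF S])
  qed
  then show ?thesis
    using two_sided_mult_permutes[OF ag] by (simp add: graph_aut_def) (simp add: cayley_graph_def)
qed

text \<open>By normality, conjugating right multiplication by \<open>y\<close> with \<open>f\<close>
  yields right multiplication by some \<open>a\<close>. Applying this to \<one> gives
  \<open>a = f y\<close>, and applying it to \<open>x\<close> gives multiplicativity.\<close>

lemma normal_cayley_graph_stabilizer_hom:
  assumes S: "S \<subseteq> carrier G" and nrm: "normal_cayley_graph G S"
    and f: "f \<in> carrier (graph_aut (cayley_graph G S))" and f1: "f \<one> = \<one>"
    and xy: "x \<in> carrier G" "y \<in> carrier G"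
  shows "f (x \<otimes> y) = f x \<otimes> f y"
proof -
  let ?A = "graph_aut (cayley_graph G S)"
  let ?R = "\<lambda>a x. if x \<in> carrier G then x \<otimes> a else x"
  interpret A: group ?A by (rule group_graph_aut)
  interpret N: normal "right_regular G" ?A using nrm by (simp add: normal_cayley_graph_def)
  have R: "?R y \<in> right_regular G" using xy by (auto simp: right_regular_def)
  then have RA: "?R y \<in> carrier ?A" using N.subset by blast
  define k where "k = f \<otimes>\<^bsub>?A\<^esub> ?R y \<otimes>\<^bsub>?A\<^esub> inv\<^bsub>?A\<^esub> f"
  have k: "k \<in> right_regular G" unfolding k_def using f R by (rule N.inv_op_closed2)
  have "k \<otimes>\<^bsub>?A\<^esub> f = f \<otimes>\<^bsub>?A\<^esub> ?R y" unfolding k_def using f RA by (simp add: A.m_assoc)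
  then have kf: "k (f z) = f (?R y z)" for z by (auto simp: graph_aut_def fun_eq_iff)
  obtain a where a: "a \<in> carrier G" "k = ?R a" using k by (auto simp: right_regular_def)
  have fc: "f z \<in> carrier G" if "z \<in> carrier G" for z
    using f that by (auto simp: graph_aut_def cayley_graph_def permutes_in_image)
  have "a = f y" using kf[of \<one>] a f1 xy by simp
  then show ?thesis using kf[of x] a xy fc by simp
qed

text \<open>The neighbours of \<one> are exactly the elements of \<open>S\<close>, and
  \<open>f\<close> fixes \<one>.\<close>

lemma graph_aut_stabilizer_preserves_connection_set:
  assumes S: "S \<subseteq> carrier G"
    and f: "f \<in> carrier (graph_aut (cayley_graph G S))" and f1: "f \<one> = \<one>"
    and s: "s \<in> carrier G"
  shows "f s \<in> S \<longleftrightarrow> s \<in> S"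
proof -
  have "f s \<in> carrier G"
    using f s by (auto simp: graph_aut_def cayley_graph_def permutes_in_image)
  moreover have "(f \<one>, f s) \<in> parcs (cayley_graph G S) \<longleftrightarrow> (\<one>, s) \<in> parcs (cayley_graph G S)"
    using f s by (simp add: graph_aut_def) (simp add: cayley_graph_def)
  ultimately show ?thesis using s f1 by (simp add: cayley_arc_iff[OF S])
qed

end

section \<open>Transposition graph automorphisms and the stabilizer of the identity\<close>

text \<open>Conjugation by \<open>g\<close> relabels \<open>(i j)\<close> as
  \<open>(g i g j)\<close>, so preserving edges means preserving \<open>S\<close>. Quantifying over
  all permutations \<open>s\<close> matches the invariance condition of
  \<open>two_sided_mult_in_graph_aut\<close>.\<close>

lemma graph_aut_transposition_graph_iff:
  assumes S: "S \<subseteq> transpositions n" and g: "g permutes {1..n}"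
  shows "g \<in> carrier (graph_aut (transposition_graph n S)) \<longleftrightarrow>
    (\<forall>s. s permutes {1..n} \<longrightarrow> (g \<circ> s \<circ> inv' g \<in> S \<longleftrightarrow> s \<in> S))"
    (is "?L \<longleftrightarrow> ?R")
proof
  have bg: "bij g" using g by (rule permutes_bij)
  have gi: "g i \<in> {1..n} \<longleftrightarrow> i \<in> {1..n}" for i using g by (rule permutes_in_image)
  have ginj: "g i = g j \<longleftrightarrow> i = j" for i j using permutes_inj[OF g] by (auto dest: injD)
  {
    assume R: ?R
    have "transp (g i) (g j) \<in> S \<longleftrightarrow> transp i j \<in> S" if "i \<in> {1..n}" "j \<in> {1..n}" for i j
      using R[rule_format, OF permutes_swap_id[OF that]] by (simp add: conj_transp[OF bg])
    then show ?L
      using g gi ginj unfolding graph_aut_def transposition_graph_def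
      by (auto simp del: atLeastAtMost_iff)
  next
    assume L: ?L
    have tr: "transp (g i) (g j) \<in> S \<longleftrightarrow> transp i j \<in> S"
      if "i \<in> {1..n}" "j \<in> {1..n}" "i \<noteq> j" for i j
      using L that gi ginj unfolding graph_aut_def transposition_graph_def
      by (auto simp del: atLeastAtMost_iff)
    show ?R
    proof (intro allI impI iffI)
      fix s assume "s \<in> S"
      then obtain i j where "i \<in> {1..n}" "j \<in> {1..n}" "i \<noteq> j" "s = transp i j"
        using S by (auto simp: transpositions_def)
      then show "g \<circ> s \<circ> inv' g \<in> S" using tr \<open>s \<in> S\<close> by (simp add: conj_transp[OF bg])
    next
      fix s assume *: "g \<circ> s \<circ> inv' g \<in> S"
      then obtain i j where ij: "i \<in> {1..n}" "j \<in> {1..n}" "i \<noteq> j" "g \<circ> s \<circ> inv' g = transp i j"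
        using S by (auto simp: transpositions_def)
      \<comment> \<open>Here \<open>s\<close> is an arbitrary permutation; pulling \<open>i\<close>
        and \<open>j\<close> back along \<open>g\<close> shows that it is itself a
        transposition.\<close>
      define k l where "k = inv' g i" and "l = inv' g j"
      have kl: "i = g k" "j = g l" using permutes_inverses[OF g] by (auto simp: k_def l_def)
      have "g \<circ> s \<circ> inv' g = g \<circ> transp k l \<circ> inv' g" using ij kl conj_transp[OF bg] by simp
      then have "g (s x) = g (transp k l x)" for x
        using permutes_inverses[OF g] by (auto simp: fun_eq_iff dest: spec[of _ "g x"])
      then have "s = transp k l" using ginj by auto
      then show "s \<in> S" using tr[of k l] ij kl gi ginj * by auto
    qed
  }
qed

text \<open>This is the triviality of the centre. If \<open>g\<close> moved \<open>i\<close>, a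
  third point \<open>k\<close> outside \<open>{i, g i}\<close> would give
  \<open>(g i g k) = (i k)\<close>, forcing \<open>g i\<close> to be \<open>i\<close> or
  \<open>k\<close>. It yields injectivity of the final map.\<close>

lemma permutes_commuting_with_transp_eq_id:
  assumes g: "g permutes A" and "finite A" "card A \<ge> 3"
    and comm: "\<And>i j. i \<in> A \<Longrightarrow> j \<in> A \<Longrightarrow> g \<circ> transp i j \<circ> inv' g = transp i j"
  shows "g = id"
proof
  fix i
  show "g i = id i"
  proof (cases "i \<in> A")
    case True
    show ?thesis
    proof (rule ccontr)
      assume neq: "g i \<noteq> id i"
      have "card {i, g i} < card A" using assms(3) card_insert_le_m1[of 2 "{g i}" i] by simp
      then have "\<not> A \<subseteq> {i, g i}" by (meson card_mono finite.intros leD)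
      then obtain k where k: "k \<in> A" "k \<noteq> i" "k \<noteq> g i" by blast
      have "transp (g i) (g k) = transp i k"
        using comm[OF True k(1)] by (simp add: conj_transp permutes_bij[OF g])
      moreover have "g i \<noteq> g k" using k permutes_inj[OF g] by (auto dest: injD)
      ultimately show False using k neq by (auto simp: transp_eq_transp_iff)
    qed
  qed (use g in \<open>simp add: permutes_not_in\<close>)
qed

text \<open>An element of \<open>S\<close> serves as a seed: its image lies in \<open>S\<close> and
  so is a transposition, and conjugacy spreads this to every transposition. Hence the condition that
  \<open>S\<close> is nonempty.\<close>

lemma graph_aut_cayley_stabilizer_is_conjugation:
  assumes n: "n \<ge> 3" and S: "S \<subseteq> transpositions n" and ne: "S \<noteq> {}"
    and nrm: "normal_cayley_graph (sym_group n) S"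
    and f: "f \<in> carrier (graph_aut (cayley_graph (sym_group n) S))" and fid: "f id = id"
  obtains g where "g \<in> carrier (graph_aut (transposition_graph n S))" "g permutes {1..n}"
    "\<And>x. x permutes {1..n} \<Longrightarrow> f x = g \<circ> x \<circ> inv' g"
proof -
  interpret H: group "sym_group n" by (rule sym_group_is_group)
  have SH: "S \<subseteq> carrier (sym_group n)"
    using S by (auto simp: transpositions_def sym_group_carrier permutes_swap_id)
  have fp: "f permutes {\<pi>. \<pi> permutes {1..n}}"
    using f by (simp add: graph_aut_def cayley_graph_def sym_group_def)
  have f1: "f \<one>\<^bsub>sym_group n\<^esub> = \<one>\<^bsub>sym_group n\<^esub>" using fid by (simp add: sym_group_one)
  have hom: "f (\<pi> \<circ> \<sigma>) = f \<pi> \<circ> f \<sigma>" if "\<pi> permutes {1..n}" "\<sigma> permutes {1..n}" for \<pi> \<sigma>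
    using H.normal_cayley_graph_stabilizer_hom[OF SH nrm f f1, of \<pi> \<sigma>] that
    unfolding sym_group_carrier sym_group_mult by blast
  have fS: "f s \<in> S \<longleftrightarrow> s \<in> S" if "s permutes {1..n}" for s
    using H.graph_aut_stabilizer_preserves_connection_set[OF SH f f1] that
    by (simp add: sym_group_carrier)
  have fperm: "f \<pi> permutes {1..n}" if "\<pi> permutes {1..n}" for \<pi>
    using permutes_in_image[OF fp, of \<pi>] that by simp
  obtain s where "s \<in> S" using ne by blast
  then obtain u v where uv: "u \<in> {1..n}" "v \<in> {1..n}" "u \<noteq> v" "transp u v \<in> S"
    using S by (auto simp: transpositions_def)
  then have "f (transp u v) \<in> transpositions n"
    using fS[OF permutes_swap_id[of u "{1..n}" v]] S by blast
  then obtain k l where kl: "k \<in> {1..n}" "l \<in> {1..n}" "k \<noteq> l" "f (transp u v) = transp k l"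
    by (auto simp: transpositions_def)
  \<comment> \<open>All transpositions are conjugate to \<open>(u v)\<close>.\<close>
  have transp: "\<exists>a\<in>{1..n}. \<exists>b\<in>{1..n}. a \<noteq> b \<and> f (transp i j) = transp a b"
    if ij: "i \<in> {1..n}" "j \<in> {1..n}" "i \<noteq> j" for i j
  proof -
    obtain h where h: "h permutes {1..n}" "h u = i" "h v = j"
      using ex_permutes_two_points[OF uv(1,2) ij(1,2) uv(3) ij(3)] .
    have tuv: "transp u v permutes {1..n}" using uv by (intro permutes_swap_id)
    have tij: "transp i j = h \<circ> transp u v \<circ> inv' h"
      using conj_transp[OF permutes_bij[OF h(1)], of u v] h by simp
    \<comment> \<open>Multiplicativity and \<open>f id = id\<close> show that \<open>f\<close>
      respects inverses, so it carries conjugates of \<open>(u v)\<close> to conjugates of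
      \<open>(k l)\<close>.\<close>
    have "f h \<circ> f (inv' h) = id"
      using hom[OF h(1) permutes_inv[OF h(1)]] permutes_inv_o[OF h(1)] fid by simp
    moreover have "f (inv' h) \<circ> f h = id"
      using hom[OF permutes_inv[OF h(1)] h(1)] permutes_inv_o[OF h(1)] fid by simp
    ultimately have "f (inv' h) = inv' (f h)" by (metis inv_unique_comp)
    then have "f (transp i j) = f h \<circ> transp k l \<circ> inv' (f h)"
      unfolding tij using h tuv kl by (simp add: hom permutes_compose permutes_inv)
    also have "\<dots> = transp (f h k) (f h l)"
      using permutes_bij[OF fperm[OF h(1)]] by (rule conj_transp)
    finally have "f (transp i j) = transp (f h k) (f h l)" .
    moreover have "f h k \<in> {1..n}" "f h l \<in> {1..n}"
      using permutes_in_image[OF fperm[OF h(1)]] kl by blast+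
    moreover have "f h k \<noteq> f h l"
      using permutes_inj[OF fperm[OF h(1)]] kl by (auto dest: injD)
    ultimately show ?thesis by blast
  qed
  have "\<exists>g. g permutes {1..n} \<and> (\<forall>\<pi>. \<pi> permutes {1..n} \<longrightarrow> f \<pi> = g \<circ> \<pi> \<circ> inv' g)"
  proof (rule transp_preserving_endomorphism_is_conjugation[of _ 1 2 3])
    show "inj_on f {\<pi>. \<pi> permutes {1..n}}" using fp by (rule permutes_inj_on)
  qed (use n hom transp in auto)
  then obtain g where g: "g permutes {1..n}" "\<And>x. x permutes {1..n} \<Longrightarrow> f x = g \<circ> x \<circ> inv' g"
    by blast
  then have "g \<in> carrier (graph_aut (transposition_graph n S))"
    using fS by (simp add: graph_aut_transposition_graph_iff[OF S])
  then show thesis using g that by blast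
qed

section \<open>The isomorphism onto the full automorphism group\<close>

theorem theorem2:
  fixes n :: nat and S :: "(nat \<Rightarrow> nat) set"
  assumes "n \<ge> 3"
    and "S \<subseteq> transpositions n"
    and "generate (sym_group n) S = carrier (sym_group n)"
    and "normal_cayley_graph (sym_group n) S"
  shows "graph_aut (cayley_graph (sym_group n) S) \<cong>
    sym_group n \<times>\<times> graph_aut (transposition_graph n S)"
proof -
  let ?H = "sym_group n"
  let ?A = "graph_aut (cayley_graph ?H S)"
  let ?K = "graph_aut (transposition_graph n S)"
  define \<Phi> where "\<Phi> = (\<lambda>(a, g). two_sided_mult ?H a g)"
  interpret H: group ?H by (rule sym_group_is_group)
  interpret A: group ?A by (rule group_graph_aut)
  interpret K: group ?K by (rule group_graph_aut)
  interpret P: group "?H \<times>\<times> ?K" by (rule DirProd_group) unfold_locales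
  have SH: "S \<subseteq> carrier ?H"
    using assms(2) by (auto simp: transpositions_def sym_group_carrier permutes_swap_id)
  have KH: "g \<in> carrier ?H" if "g \<in> carrier ?K" for g
    using subgroup.subset[OF subgroup_graph_aut_transposition_graph] that by blast
  have multA: "mult ?A = (\<circ>)" and oneA: "\<one>\<^bsub>?A\<^esub> = id" and multK: "mult ?K = mult ?H"
    and oneK: "\<one>\<^bsub>?K\<^esub> = \<one>\<^bsub>?H\<^esub>"
    by (simp_all add: graph_aut_def sym_group_def)
  have "\<Phi> (a, g) \<in> carrier ?A" if "a \<in> carrier ?H" "g \<in> carrier ?K" for a g
    unfolding \<Phi>_def prod.case
  proof (rule H.two_sided_mult_in_graph_aut[OF SH that(1) KH[OF that(2)]])
    fix s assume "s \<in> carrier ?H"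
    then show "g \<otimes>\<^bsub>?H\<^esub> s \<otimes>\<^bsub>?H\<^esub> inv\<^bsub>?H\<^esub> g \<in> S \<longleftrightarrow> s \<in> S"
      using that KH[OF that(2)] graph_aut_transposition_graph_iff[OF assms(2), of g]
      by (simp add: sym_group_carrier sym_group_mult)
  qed
  then have "\<Phi> \<in> hom (?H \<times>\<times> ?K) ?A"
    by (auto simp: hom_def multA multK \<Phi>_def KH H.two_sided_mult_comp)
  then interpret \<Phi>: group_hom "?H \<times>\<times> ?K" ?A \<Phi> by unfold_locales
  have ker: "a = \<one>\<^bsub>?H\<^esub> \<and> g = \<one>\<^bsub>?K\<^esub>"
    if ag: "a \<in> carrier ?H" "g \<in> carrier ?K" "\<Phi> (a, g) = \<one>\<^bsub>?A\<^esub>" for a g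
  proof -
    have g: "g \<in> carrier ?H" using ag KH by blast
    have fixed: "g \<otimes>\<^bsub>?H\<^esub> x \<otimes>\<^bsub>?H\<^esub> inv\<^bsub>?H\<^esub> a = x" if "x \<in> carrier ?H" for x
      using fun_cong[OF ag(3), of x] that by (simp add: \<Phi>_def two_sided_mult_def oneA)
    \<comment> \<open>Evaluation at the identity gives \<open>g = a\<close>, after which
      \<open>g\<close> commutes with every transposition.\<close>
    have "g = a" using fixed[of "\<one>\<^bsub>?H\<^esub>"] ag g
      by (metis H.inv_solve_right' H.l_one H.one_closed H.r_one)
    then have "g \<circ> transp i j \<circ> inv' g = transp i j" if "i \<in> {1..n}" "j \<in> {1..n}" for i j
      using fixed[of "transp i j"] g that
      by (simp add: sym_group_carrier sym_group_mult permutes_swap_id)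
    then have "g = id"
      using g assms(1)
      by (intro permutes_commuting_with_transp_eq_id[of g "{1..n}"]) (auto simp: sym_group_carrier)
    then show ?thesis using \<open>g = a\<close> by (simp add: oneK sym_group_one)
  qed
  \<comment> \<open>Generation supplies the seed transposition: the empty set generates the trivial
    group, which misses \<open>(1 2)\<close>.\<close>
  have "S \<noteq> {}"
  proof
    assume "S = {}"
    then have "carrier ?H = {id}" using assms(3) H.generate_empty by (simp add: sym_group_one)
    moreover have "transp 1 2 \<in> carrier ?H"
      using assms(1) by (auto simp: sym_group_carrier intro!: permutes_swap_id)
    ultimately show False using transpose_eq_id_iff[of 1 "2::nat"] by simp
  qed
  have surj: "f \<in> \<Phi> ` carrier (?H \<times>\<times> ?K)" if f: "f \<in> carrier ?A" for f
  proof -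
    have fp: "f permutes carrier ?H" using f by (simp add: graph_aut_def cayley_graph_def)
    define b where "b = f id"
    have id: "id \<in> carrier ?H" using H.one_closed by (simp add: sym_group_one)
    have b: "b \<in> carrier ?H" using permutes_in_image[OF fp] id by (simp add: b_def)
    \<comment> \<open>Following \<open>f\<close> by right multiplication with the inverse of
      \<open>b = f id\<close> produces an automorphism fixing the identity.\<close>
    define f' where "f' = two_sided_mult ?H b \<one>\<^bsub>?H\<^esub> \<circ> f"
    have "two_sided_mult ?H b \<one>\<^bsub>?H\<^esub> \<in> carrier ?A"
      using SH b by (intro H.two_sided_mult_in_graph_aut) auto
    then have "f' \<in> carrier ?A" using A.m_closed f by (simp add: f'_def multA)
    moreover have "f' id = id"
      using b H.l_one[OF b] H.r_inv[OF b]
      by (simp add: f'_def two_sided_mult_def sym_group_one flip: b_def)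
    ultimately obtain g where g: "g \<in> carrier ?K" "g permutes {1..n}"
        "\<And>x. x permutes {1..n} \<Longrightarrow> f' x = g \<circ> x \<circ> inv' g"
      using graph_aut_cayley_stabilizer_is_conjugation[OF assms(1,2) \<open>S \<noteq> {}\<close> assms(4)] by metis
    have gH: "g \<in> carrier ?H" using g KH by blast
    \<comment> \<open>Undoing the correction gives \<open>f x\<close> as \<open>g\<close> times
      \<open>x\<close> times \<open>inv g\<close> times \<open>b\<close>, and \<open>inv g\<close>
      times \<open>b\<close> is the inverse of \<open>inv b\<close> times \<open>g\<close>; this
      determines the first component.\<close>
    have "f x = \<Phi> (inv\<^bsub>?H\<^esub> b \<otimes>\<^bsub>?H\<^esub> g, g) x" for x
    proof (cases "x \<in> carrier ?H")
      case True
      then have fx: "f x \<in> carrier ?H" using permutes_in_image[OF fp] by simp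
      have "f x \<otimes>\<^bsub>?H\<^esub> inv\<^bsub>?H\<^esub> b = f' x"
        using True fx by (simp add: f'_def two_sided_mult_def)
      also have "\<dots> = g \<circ> x \<circ> inv' g" using g(3) True by (simp add: sym_group_carrier)
      also have "\<dots> = g \<otimes>\<^bsub>?H\<^esub> x \<otimes>\<^bsub>?H\<^esub> inv\<^bsub>?H\<^esub> g" using gH by (simp add: sym_group_mult)
      finally have "f x \<otimes>\<^bsub>?H\<^esub> inv\<^bsub>?H\<^esub> b = g \<otimes>\<^bsub>?H\<^esub> x \<otimes>\<^bsub>?H\<^esub> inv\<^bsub>?H\<^esub> g" .
      then have "f x = g \<otimes>\<^bsub>?H\<^esub> x \<otimes>\<^bsub>?H\<^esub> inv\<^bsub>?H\<^esub> g \<otimes>\<^bsub>?H\<^esub> b"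
        using fx gH b True by (metis H.inv_solve_right H.inv_closed H.inv_inv H.m_closed)
      then show ?thesis
        using True gH b by (simp add: \<Phi>_def two_sided_mult_def H.inv_mult_group H.m_assoc
            del: sym_group_inv_equality)
    next
      case False
      then show ?thesis using fp by (simp add: \<Phi>_def two_sided_mult_def permutes_not_in)
    qed
    then have "f = \<Phi> (inv\<^bsub>?H\<^esub> b \<otimes>\<^bsub>?H\<^esub> g, g)" by blast
    moreover have "inv\<^bsub>?H\<^esub> b \<otimes>\<^bsub>?H\<^esub> g \<in> carrier ?H" using H.inv_closed[OF b] gH by (rule H.m_closed)
    ultimately show ?thesis using g by auto
  qed
  have "\<Phi> \<in> iso (?H \<times>\<times> ?K) ?A"
    using surj ker by (auto simp: \<Phi>.iso_iff)
  \<comment> \<open>\<open>\<Phi>\<close> starts from the direct product, opposite to the stated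
    direction.\<close>
  then show ?thesis using P.iso_sym is_isoI by blast
qed

end
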